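(* Let $\mathcal{P}$ denote the set of prime numbers, and for $N\in\mathbb{N}=\{1,2,3,\dots\}$ let $$D(\mathcal{P},N)=\max\{|A| : A\subseteq\{1,2,\dots,N\},\ (A-A)\cap\mathcal{P}\subseteq\{0\}\}.$$ Then for all $N\in\mathbb{N}$, $$D(\mathcal{P},N)=\lceil N/4\rceil+1_E(N),\qquad E=\{2,3,4,11,12\},$$ where $1_E$ is the indicator function of $E$.
   Context: For a set $A$ of integers, $A-A=\{a-b: a,b\in A\}$. Thus $D(\mathcal{P},N)$ is the maximum size of a subset of $\{1,\dots,N\}$ no two distinct elements of which differ by a prime. *)

theory Defs
  imports Complex_Main "HOL-Computational_Algebra.Primes" "HOL-Library.Indicator_Function"
begin

text \<open>The operator \<open>-\<close> on sets is set difference, so the set of differences gets its own name.\<close>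

definition difference_set :: "int set \<Rightarrow> int set" where
  "difference_set A = {a - b | a b. a \<in> A \<and> b \<in> A}"

definition D :: "int set \<Rightarrow> nat \<Rightarrow> nat" where
  "D S N = Max {card A | A. A \<subseteq> {1..int N} \<and> difference_set A \<inter> S \<subseteq> {0}}"

text \<open>A prime element of type \<^typ>\<open>int\<close> is positive by definition of \<^const>\<open>prime\<close>.\<close>

definition primes :: "int set" where
  "primes = {p. prime p}"

end

theory Submission
  imports Defs
begin

text \<open>The multiples of 4 plus 1 give the lower bound \<open>\<lceil>N/4\<rceil>\<close>, and \<open>{1, 2}\<close> and \<open>{1, 2, 10, 11}\<close> the
  exceptional values. For the upper bound, two distinct elements of 8 consecutive integers can only
  differ by 1, 4 or 6, and no element of \<open>{1, 4, 6}\<close> is a sum of two such, so every 8 consecutive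
  integers contain at most two elements. Hence a bound for length \<open>N\<close> gives one for \<open>N + 8\<close>, and
  only the lengths 10 and 20 need a separate argument: there, exceeding the bound would force
  adjacent pairs in several blocks, and two of those pairs would show a prime difference.\<close>

definition prime_free :: "int set \<Rightarrow> bool" where
  "prime_free A \<longleftrightarrow> (\<forall>a\<in>A. \<forall>b\<in>A. \<not> prime (a - b))"

text \<open>Since 0 is not prime, an intersection with \<open>primes\<close> contained in {0} is
  empty.\<close>

lemma difference_set_primes_iff: "difference_set A \<inter> primes \<subseteq> {0} \<longleftrightarrow> prime_free A"
proof -
  have "difference_set A \<inter> primes \<subseteq> {0} \<longleftrightarrow> (\<forall>d\<in>difference_set A. \<not> prime d)"
    using not_prime_0[where 'a = int] unfolding primes_def by blast
  then show ?thesis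
    unfolding difference_set_def prime_free_def by blast
qed

text \<open>2, 3, 5 and 7 govern short distances; 11 and 17 enter in windows of length 20.\<close>

lemma prime_free_diff_neq:
  assumes "prime_free A" "a \<in> A" "b \<in> A"
  shows "a - b \<notin> {2, 3, 5, 7, 11, 17}"
proof
  assume "a - b \<in> {2, 3, 5, 7, 11, 17}"
  moreover have "\<forall>p \<in> {2, 3, 5, 7, 11, 17 :: int}. prime p"
    by simp
  ultimately show False
    using assms unfolding prime_free_def by blast
qed

lemma prime_free_close:
  assumes "prime_free A" "a \<in> A" "b \<in> A" "a \<noteq> b" "\<bar>a - b\<bar> \<le> 7"
  shows "\<bar>a - b\<bar> \<in> {1, 4, 6}"
proof -
  have "\<bar>a - b\<bar> \<notin> {2, 3, 5, 7, 11, 17}"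
    using prime_free_diff_neq[OF assms(1-3)] prime_free_diff_neq[OF assms(1,3,2)]
    by (cases "b \<le> a") simp_all
  moreover have "\<bar>a - b\<bar> \<noteq> 0"
    using assms(4) by simp
  ultimately show ?thesis
    using assms(5) by (simp only: insert_iff empty_iff) presburger
qed

text \<open>The window is open on the left, so it holds exactly \<open>n\<close> integers and
  adjacent windows tile.\<close>

definition count_in :: "int set \<Rightarrow> int \<Rightarrow> nat \<Rightarrow> nat" where
  "count_in A x n = card (A \<inter> {x<..x + int n})"

lemma count_in_le: "count_in A x n \<le> n"
proof -
  have "card (A \<inter> {x<..x + int n}) \<le> card {x<..x + int n}"
    by (intro card_mono) auto
  then show ?thesis by (simp add: count_in_def)
qed

lemma count_in_mono: "m \<le> n \<Longrightarrow> count_in A x m \<le> count_in A x n"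
  unfolding count_in_def by (intro card_mono) auto

lemma count_in_add: "count_in A x (m + n) = count_in A x m + count_in A (x + int m) n"
proof -
  have "A \<inter> {x<..x + int (m + n)} =
      (A \<inter> {x<..x + int m}) \<union> (A \<inter> {x + int m<..x + int m + int n})"
    by auto
  also have "card \<dots> = count_in A x m + count_in A (x + int m) n"
    unfolding count_in_def by (intro card_Un_disjoint) auto
  finally show ?thesis
    by (simp add: count_in_def)
qed

lemma count_in_8_le:
  assumes "prime_free A"
  shows "count_in A x 8 \<le> 2"
proof (rule ccontr)
  let ?B = "A \<inter> {x<..x + 8}"
  assume "\<not> count_in A x 8 \<le> 2"
  then have "3 \<le> card ?B"
    by (simp add: count_in_def)
  then obtain T where "T \<subseteq> ?B" "card T = 3"
    by (meson obtain_subset_with_card_n)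
  then obtain a b c where abc: "a \<in> ?B" "b \<in> ?B" "c \<in> ?B" "a \<noteq> b" "a \<noteq> c" "b \<noteq> c"
    by (auto simp: card_3_iff)
  have "\<bar>u - v\<bar> \<in> {1, 4, 6}" if "u \<in> ?B" "v \<in> ?B" "u \<noteq> v" for u v
    using that by (intro prime_free_close[OF assms]) auto
  from this[of a b] this[of a c] this[of b c] abc
  have "\<bar>a - b\<bar> \<in> {1, 4, 6}" "\<bar>a - c\<bar> \<in> {1, 4, 6}" "\<bar>b - c\<bar> \<in> {1, 4, 6}"
    by blast+
  \<comment> \<open>The largest distance is the sum of the other two, but sums of two elements of
    {1, 4, 6} are 2, 5, 7, 8, 10 or 12.\<close>
  then show False
    by (simp only: insert_iff empty_iff) presburger
qed

text \<open>Distances in such a window are at most 3, and only 1 survives among them.\<close>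

lemma adjacent_pair:
  assumes "prime_free A" "n \<le> 4" "2 \<le> count_in A x n"
  obtains a where "a \<in> A" "a + 1 \<in> A" "x < a" "a < x + int n"
proof -
  let ?B = "A \<inter> {x<..x + int n}"
  obtain T where "T \<subseteq> ?B" "card T = 2"
    using assms(3) unfolding count_in_def by (meson obtain_subset_with_card_n)
  then obtain a b where ab: "a \<in> ?B" "b \<in> ?B" "a \<noteq> b"
    by (auto simp: card_2_iff)
  then have "\<bar>a - b\<bar> < 4"
    using assms(2) by auto
  moreover from this have "\<bar>a - b\<bar> \<in> {1, 4, 6}"
    using ab by (intro prime_free_close[OF assms(1)]) auto
  ultimately have "a = b + 1 \<or> b = a + 1"
    by auto
  then show thesis
    using ab that[of a] that[of b] by auto
qed

text \<open>Splitting as 8 + 2 and as 2 + 8, four elements would fill both end pairs, whose inner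
  members differ by 7.\<close>

lemma count_in_10_le:
  assumes "prime_free A"
  shows "count_in A x 10 \<le> 3"
proof (rule ccontr)
  assume "\<not> count_in A x 10 \<le> 3"
  then have "2 \<le> count_in A x 2" "2 \<le> count_in A (x + 8) 2"
    using count_in_add[of A x 8 2] count_in_add[of A x 2 8]
      count_in_8_le[OF assms, of x] count_in_8_le[OF assms, of "x + 2"] by simp_all
  obtain a where a: "a + 1 \<in> A" "x < a" "a < x + int 2"
    using adjacent_pair[OF assms _ \<open>2 \<le> count_in A x 2\<close>] by auto
  obtain b where b: "b \<in> A" "x + 8 < b" "b < x + 8 + int 2"
    using adjacent_pair[OF assms _ \<open>2 \<le> count_in A (x + 8) 2\<close>] by auto
  have "b - (a + 1) = 7"
    using a b by simp
  then show False
    using prime_free_diff_neq[OF assms b(1) a(1)] by simp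
qed

text \<open>With d = \<open>b - a\<close>, none of d - 1, d, d + 1 may be prime: 5 and 7 exclude 6,
  7 and 8, and 11 excludes 10.\<close>

lemma adjacent_pairs_diff:
  assumes "prime_free A" "a \<in> A" "a + 1 \<in> A" "b \<in> A" "b + 1 \<in> A" "6 \<le> b - a" "b - a \<le> 10"
  shows "b - a = 9"
  using prime_free_diff_neq[OF assms(1,4,2)] prime_free_diff_neq[OF assms(1,4,3)]
    prime_free_diff_neq[OF assms(1,5,2)] assms(6,7)
  by (simp only: insert_iff empty_iff) presburger

lemma count_in_20_le:
  assumes "prime_free A"
  shows "count_in A x 20 \<le> 5"
proof (rule ccontr)
  assume "\<not> count_in A x 20 \<le> 5"
  \<comment> \<open>The short window takes each possible place beside two windows of length 8. These
    hold at most 4 elements together, so a sixth element forces two into the short one.\<close>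
  moreover have "count_in A x 20 = count_in A x 4 + count_in A (x + 4) 8 + count_in A (x + 12) 8"
      "count_in A x 20 = count_in A x 8 + count_in A (x + 8) 4 + count_in A (x + 12) 8"
      "count_in A x 20 = count_in A x 8 + count_in A (x + 8) 8 + count_in A (x + 16) 4"
    using count_in_add[of A x 4 16] count_in_add[of A "x + 4" 8 8] count_in_add[of A x 8 12]
      count_in_add[of A "x + 8" 4 8] count_in_add[of A "x + 8" 8 4]
    by (simp_all add: add.assoc)
  moreover have "count_in A y 8 \<le> 2" for y
    using count_in_8_le[OF assms] .
  from this[of x] this[of "x + 4"] this[of "x + 8"] this[of "x + 12"] calculation
  have "2 \<le> count_in A x 4" "2 \<le> count_in A (x + 8) 4" "2 \<le> count_in A (x + 16) 4"
    by linarith+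
  obtain a where a: "a \<in> A" "a + 1 \<in> A" "x < a" "a < x + int 4"
    using adjacent_pair[OF assms _ \<open>2 \<le> count_in A x 4\<close>] by auto
  obtain b where b: "b \<in> A" "b + 1 \<in> A" "x + 8 < b" "b < x + 8 + int 4"
    using adjacent_pair[OF assms _ \<open>2 \<le> count_in A (x + 8) 4\<close>] by auto
  obtain c where c: "c \<in> A" "c + 1 \<in> A" "x + 16 < c" "c < x + 16 + int 4"
    using adjacent_pair[OF assms _ \<open>2 \<le> count_in A (x + 16) 4\<close>] by auto
  have "b - a = 9"
    using a b by (intro adjacent_pairs_diff[OF assms]) auto
  moreover have "c - b = 9"
    using b c by (intro adjacent_pairs_diff[OF assms]) auto
  ultimately have "c - (a + 1) = 17"
    by simp
  then show False
    using prime_free_diff_neq[OF assms c(1) a(2)] by simp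
qed

text \<open>\<open>(n + 3) div 4\<close> is the ceiling of n/4 in natural numbers.\<close>

definition extremal :: "nat \<Rightarrow> nat" where
  "extremal n = (n + 3) div 4 + (if n \<in> {2, 3, 4, 11, 12} then 1 else 0)"

lemma count_in_le_extremal:
  assumes "prime_free A"
  shows "count_in A x n \<le> extremal n"
proof (induction n arbitrary: x rule: less_induct)
  case (less n)
  \<comment> \<open>Passing from n - 8 to n adds 2 to \<open>extremal\<close> unless n - 8 is
    exceptional and n is not, that is, n = 10, 19 or 20.\<close>
  consider "n \<le> 2" | "3 \<le> n" "n \<le> 8" | "n = 10" | "n = 19 \<or> n = 20"
    | "8 < n" "n \<notin> {10, 19, 20}"
    by fastforce
  then show ?case
  proof cases
    case 1
    then have "n = 0 \<or> n = 1 \<or> n = 2" by auto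
    then show ?thesis
      using count_in_le[of A x n] by (auto simp: extremal_def)
  next
    case 2
    then have "n \<in> {3, 4} \<or> 2 \<le> (n + 3) div 4"
      by auto
    then have "2 \<le> extremal n"
      by (auto simp: extremal_def)
    then show ?thesis
      using count_in_mono[of n 8 A x] count_in_8_le[OF assms, of x] 2 by simp
  next
    case 3
    then show ?thesis
      using count_in_10_le[OF assms] by (simp add: extremal_def)
  next
    case 4
    then show ?thesis
      using count_in_mono[of n 20 A x] count_in_20_le[OF assms, of x]
      by (auto simp: extremal_def)
  next
    case 5
    then obtain m where m: "n = 8 + m" "0 < m"
      using less_imp_add_positive by blast
    have "extremal n = 2 + extremal m"
      using m 5 by (auto simp: extremal_def)
    then show ?thesis
      using less.IH[of m "x + 8"] count_in_8_le[OF assms, of x] count_in_add[of A x 8 m] m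
      by simp
  qed
qed

lemma prime_free_card_le_extremal:
  assumes "prime_free A" "A \<subseteq> {1..int N}"
  shows "card A \<le> extremal N"
proof -
  have "A \<inter> {0<..0 + int N} = A"
    using assms(2) by auto
  then show ?thesis
    using count_in_le_extremal[OF assms(1), of 0 N] by (simp add: count_in_def)
qed

text \<open>Differences are multiples of 4, while an even prime must equal 2.\<close>

lemma prime_free_arithmetic_progression: "prime_free ((\<lambda>k. 1 + 4 * int k) ` K)"
proof -
  have "\<not> prime (1 + 4 * int k - (1 + 4 * int l))" for k l
  proof
    assume prime: "prime (1 + 4 * int k - (1 + 4 * int l))"
    have "prime (2 :: int)" "2 dvd 1 + 4 * int k - (1 + 4 * int l)"
      by simp_all
    then have "2 = 1 + 4 * int k - (1 + 4 * int l)"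
      using primes_dvd_imp_eq prime by blast
    then show False
      by presburger
  qed
  then show ?thesis
    by (auto simp: prime_free_def)
qed

lemma prime_free_extremal_exists:
  obtains A where "prime_free A" "A \<subseteq> {1..int N}" "card A = extremal N"
proof (cases "N \<in> {2, 3, 4, 11, 12}")
  case False
  let ?A = "(\<lambda>k. 1 + 4 * int k) ` {..<(N + 3) div 4}"
  have "card ?A = extremal N"
    using False by (subst card_image) (auto simp: extremal_def inj_on_def)
  moreover have "?A \<subseteq> {1..int N}"
    by auto
  ultimately show thesis
    using that prime_free_arithmetic_progression by blast
next
  case True
  have not_prime: "\<not> prime (8 :: int)" "\<not> prime (9 :: int)" "\<not> prime (10 :: int)"
    by simp_all
  have not_prime_neg: "\<not> prime (p :: int)" if "p \<le> 1" for p
    using that prime_gt_1_int[of p] by linarith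
  show thesis
  proof (cases "N \<le> 4")
    case le: True
    show thesis
      using True le by (intro that[of "{1, 2}"])
        (auto simp: prime_free_def extremal_def not_prime_neg)
  next
    case gt: False
    \<comment> \<open>Now N is 11 or 12; the positive differences of the witness are 1, 8, 9 and
      10.\<close>
    show thesis
      using True gt by (intro that[of "{1, 2, 10, 11}"])
        (auto simp: prime_free_def extremal_def not_prime not_prime_neg)
  qed
qed

lemma D_primes_eq: "D primes N = extremal N"
proof -
  let ?F = "{A. A \<subseteq> {1..int N} \<and> prime_free A}"
  have "finite ?F"
    by (rule finite_subset[of _ "Pow {1..int N}"]) auto
  moreover have "extremal N \<in> card ` ?F"
    using prime_free_extremal_exists[of N] by (metis (mono_tags, lifting) image_eqI mem_Collect_eq)
  ultimately have "Max (card ` ?F) = extremal N"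
    by (intro Max_eqI) (auto intro: prime_free_card_le_extremal)
  moreover have "{card A | A. A \<subseteq> {1..int N} \<and> prime_free A} = card ` ?F"
    by auto
  ultimately show ?thesis
    by (simp add: D_def difference_set_primes_iff)
qed

theorem theorem1p2:
  fixes N :: nat
  assumes "N \<ge> 1"
  shows "int (D primes N) = \<lceil>real N / 4\<rceil> + indicator {2, 3, 4, 11, 12} N"
proof -
  have "\<lceil>real N / 4\<rceil> = int ((N + 3) div 4)"
  proof (rule ceiling_unique)
    have "N \<le> 4 * ((N + 3) div 4)" "4 * ((N + 3) div 4) < N + 4"
      by simp_all
    then have "real N \<le> real (4 * ((N + 3) div 4))" "real (4 * ((N + 3) div 4)) < real (N + 4)"
      by (simp_all only: of_nat_le_iff of_nat_less_iff)
    then show "real_of_int (int ((N + 3) div 4)) - 1 < real N / 4"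
        "real N / 4 \<le> real_of_int (int ((N + 3) div 4))"
      by simp_all
  qed
  then show ?thesis
    by (simp only: D_primes_eq extremal_def indicator_def of_nat_add if_distrib[of int] of_bool_def
        of_nat_0 of_nat_1)
qed

end
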